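(* Fix $\ell\ge1$ and an $\ell$-tuple of non-negative integers $\vec\alpha$, and let $\hat e_1=(1,0,\dots,0)$. Then $$\sum_{m=0}^\infty M^\ell_m(\vec\alpha,\vec\alpha,t)=M^\ell_0(\vec\alpha+\hat e_1,\vec\alpha,t).$$
   Context: An order-$\ell$ Motzkin path of length $n$ and height $m$ is an integer lattice path from $(0,0)$ to $(n,m)$ using steps $U=(1,1)$ and $D_i=(1,-i)$ for $0\le i\le \ell$, never going below $y=0$. For $\ell$-tuples of non-negative integers $\vec\alpha=(\alpha_0,\dots,\alpha_{\ell-1}),\vec\beta=(\beta_0,\dots,\beta_{\ell-1})$, an $(\vec\alpha,\vec\beta)$-colored Motzkin path is such a path in which, for each $0\le i\le \ell-1$, each $D_i$ step whose right endpoint is at height $0$ is labeled by one of $\alpha_i$ colors and each $D_i$ step whose right endpoint is at height $>0$ is labeled by one of $\beta_i$ colors; $U$ and $D_\ell$ steps are unlabeled. $M^\ell_{n,m}(\vec\alpha,\vec\beta)$ is the number of such colored paths of length $n$ and height $m$, and $M^\ell_m(\vec\alpha,\vec\beta,t)=\sum_{n\ge0}M^\ell_{n,m}(\vec\alpha,\vec\beta)t^n$. *)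

theory Defs
  imports "HOL-Computational_Algebra.Formal_Power_Series"
begin

text \<open>
  The steps are $U = (1,1)$ and $D_i = (1,-i)$.  Every step advances the abscissa by one, so a
  lattice path starting at $(0,0)$ is given by its list of steps, and its vertex with abscissa
  $k$ is \<open>(k, height w k)\<close>.
\<close>

datatype step = U | D nat

fun rise :: "step \<Rightarrow> int" where
  "rise U = 1"
| "rise (D i) = - int i"

definition height :: "step list \<Rightarrow> nat \<Rightarrow> int" where
  "height w k = sum_list (map rise (take k w))"

definition motzkin_path :: "nat \<Rightarrow> nat \<Rightarrow> nat \<Rightarrow> step list \<Rightarrow> bool" where
  "motzkin_path l n m w \<longleftrightarrow>
     length w = n \<and> set w \<subseteq> insert U (D ` {0..l}) \<and>
     (\<forall>k\<le>n. height w k \<ge> 0) \<and> height w n = int m"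

text \<open>
  An $\ell$-tuple is a function on \<open>nat\<close> of which only the values at \<open>0, \<dots>, l - 1\<close> are used.
  The set \<open>labels l \<alpha> \<beta> s h\<close> contains the admissible labels of a step \<open>s\<close> whose right endpoint
  has height \<open>h\<close>; \<open>None\<close> stands for an unlabeled step.
\<close>

fun labels :: "nat \<Rightarrow> (nat \<Rightarrow> nat) \<Rightarrow> (nat \<Rightarrow> nat) \<Rightarrow> step \<Rightarrow> int \<Rightarrow> nat option set" where
  "labels l \<alpha> \<beta> U h = {None}"
| "labels l \<alpha> \<beta> (D i) h =
     (if i < l then Some ` {..<(if h = 0 then \<alpha> i else \<beta> i)} else {None})"

definition colored_motzkin_paths ::
    "nat \<Rightarrow> (nat \<Rightarrow> nat) \<Rightarrow> (nat \<Rightarrow> nat) \<Rightarrow> nat \<Rightarrow> nat \<Rightarrow> (step list \<times> nat option list) set" where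
  "colored_motzkin_paths l \<alpha> \<beta> n m =
     {(w, c). motzkin_path l n m w \<and> length c = n \<and>
              (\<forall>k<n. c ! k \<in> labels l \<alpha> \<beta> (w ! k) (height w (Suc k)))}"

definition motzkin_number :: "nat \<Rightarrow> (nat \<Rightarrow> nat) \<Rightarrow> (nat \<Rightarrow> nat) \<Rightarrow> nat \<Rightarrow> nat \<Rightarrow> nat" where
  "motzkin_number l \<alpha> \<beta> n m = card (colored_motzkin_paths l \<alpha> \<beta> n m)"

text \<open>
  The coefficients are integers rather than naturals because the library's topology on formal
  power series requires a coefficient group.
\<close>

definition motzkin_gf :: "nat \<Rightarrow> (nat \<Rightarrow> nat) \<Rightarrow> (nat \<Rightarrow> nat) \<Rightarrow> nat \<Rightarrow> int fps" where
  "motzkin_gf l \<alpha> \<beta> m = Abs_fps (\<lambda>n. int (motzkin_number l \<alpha> \<beta> n m))"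

text \<open>Tuples are indexed from \<open>0\<close>, so $\hat e_1 = (1,0,\dots,0)$ has its \<open>1\<close> at index \<open>0\<close>.\<close>

definition e1_hat :: "nat \<Rightarrow> nat" where
  "e1_hat i = (if i = 0 then 1 else 0)"

text \<open>\<open>card\<close> is \<open>0\<close> on infinite sets; the sets counted above are finite.\<close>

lemma finite_colored_motzkin_paths: "finite (colored_motzkin_paths l \<alpha> \<beta> n m)"
proof -
  let ?S = "insert U (D ` {0..l})"
  let ?C = "insert None (\<Union>i<l. Some ` ({..<\<alpha> i} \<union> {..<\<beta> i}))"
  have lab: "labels l \<alpha> \<beta> s h \<subseteq> ?C" for s h
    by (cases s) auto
  have "w \<in> {w. set w \<subseteq> ?S \<and> length w = n} \<and> c \<in> {c. set c \<subseteq> ?C \<and> length c = n}"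
    if wc: "(w, c) \<in> colored_motzkin_paths l \<alpha> \<beta> n m" for w c
  proof -
    have "x \<in> ?C" if "x \<in> set c" for x
    proof -
      obtain k where k: "k < length c" "c ! k = x"
        using \<open>x \<in> set c\<close> unfolding in_set_conv_nth by (elim exE conjE)
      with wc have "x \<in> labels l \<alpha> \<beta> (w ! k) (height w (Suc k))"
        by (simp only: colored_motzkin_paths_def mem_Collect_eq case_prod_conv) metis
      with lab show ?thesis by (rule subsetD)
    qed
    with wc show ?thesis
      by (simp add: colored_motzkin_paths_def motzkin_path_def subset_iff)
  qed
  then have "colored_motzkin_paths l \<alpha> \<beta> n m \<subseteq>
      {w. set w \<subseteq> ?S \<and> length w = n} \<times> {c. set c \<subseteq> ?C \<and> length c = n}"
    by (intro subrelI) (simp only: mem_Sigma_iff)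
  moreover have "finite \<dots>"
    by (intro finite_cartesian_product finite_lists_length_eq) auto
  ultimately show ?thesis
    by (rule finite_subset)
qed

end

theory Submission
  imports Defs
begin

text \<open>
  Let $A_{n,m}$ and $B_{n,m}$ count the $(\vec\alpha,\vec\alpha)$-colored and the
  $(\vec\alpha+\hat e_1,\vec\alpha)$-colored paths.  Removing the last step yields recurrences in $n$,
  which propagate the identity $B_{n,m} = A_{n,m} + B_{n,m+1}$ from $n$ to $n + 1$: at $m = 0$ the
  additional color of $D_0$ contributes the same term $B_{n,0}$ to $B_{n+1,0}$ as the last step $U$
  contributes to $B_{n+1,1}$.  Since $B_{n,m} = 0$ for $m > n$, telescoping gives
  $B_{n,0} = \sum_m A_{n,m}$.
\<close>

lemma height_append_le: "k \<le> length w \<Longrightarrow> height (w @ v) k = height w k"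
  by (simp add: height_def)

lemma height_snoc: "height (w @ [s]) (Suc (length w)) = height w (length w) + rise s"
  by (simp add: height_def)

text \<open>Appending \<open>s\<close> leaves the earlier heights and label conditions untouched,
  and the new vertex at height \<open>m\<close> is automatically nonnegative. The prefix must end at
  \<open>int m - rise s\<close>; the condition \<open>rise s \<le> int m\<close> keeps
  \<open>nat\<close> from truncating a negative height to 0.\<close>

lemma snoc_mem_colored_motzkin_paths:
  assumes "length w = n" "length c = n"
  shows "(w @ [s], c @ [x]) \<in> colored_motzkin_paths l \<alpha> \<beta> (Suc n) m \<longleftrightarrow>
    s \<in> insert U (D ` {..l}) \<and> rise s \<le> int m \<and>
    (w, c) \<in> colored_motzkin_paths l \<alpha> \<beta> n (nat (int m - rise s)) \<and>
    x \<in> labels l \<alpha> \<beta> s (int m)"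
proof -
  have "motzkin_path l (Suc n) m (w @ [s]) \<longleftrightarrow>
      s \<in> insert U (D ` {..l}) \<and> rise s \<le> int m \<and> motzkin_path l n (nat (int m - rise s)) w"
    using height_snoc[of w s] assms
    by (auto simp: motzkin_path_def le_Suc_eq height_append_le atLeast0AtMost)
  moreover have "(\<forall>k<Suc n. (c @ [x]) ! k \<in> labels l \<alpha> \<beta> ((w @ [s]) ! k) (height (w @ [s]) (Suc k)))
      \<longleftrightarrow> (\<forall>k<n. c ! k \<in> labels l \<alpha> \<beta> (w ! k) (height w (Suc k))) \<and>
        x \<in> labels l \<alpha> \<beta> s (height (w @ [s]) (Suc n))"
    using assms by (auto simp: less_Suc_eq nth_append height_append_le)
  moreover have "height (w @ [s]) (Suc n) = int m" if "motzkin_path l (Suc n) m (w @ [s])"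
    using that by (simp add: motzkin_path_def)
  ultimately show ?thesis
    using assms by (auto simp: colored_motzkin_paths_def)
qed

lemma length_colored_motzkin_paths:
  "(w, c) \<in> colored_motzkin_paths l \<alpha> \<beta> n m \<Longrightarrow> length w = n \<and> length c = n"
  by (simp add: colored_motzkin_paths_def motzkin_path_def)

lemma motzkin_number_0: "motzkin_number l \<alpha> \<beta> 0 m = (if m = 0 then 1 else 0)"
proof -
  have "colored_motzkin_paths l \<alpha> \<beta> 0 m = (if m = 0 then {([], [])} else {})"
    by (auto simp: colored_motzkin_paths_def motzkin_path_def height_def)
  then show ?thesis
    by (simp add: motzkin_number_def)
qed

lemma finite_labels: "finite (labels l \<alpha> \<beta> s h)"
  by (cases s) auto

text \<open>Cutting off the end gives a bijection with triples of a last step, a shorter colored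
  path and a label for that step.\<close>

lemma motzkin_number_Suc_sum:
  "motzkin_number l \<alpha> \<beta> (Suc n) m =
    (\<Sum>s\<in>{s \<in> insert U (D ` {..l}). rise s \<le> int m}.
      motzkin_number l \<alpha> \<beta> n (nat (int m - rise s)) * card (labels l \<alpha> \<beta> s (int m)))"
proof -
  let ?S = "{s \<in> insert U (D ` {..l}). rise s \<le> int m}"
  let ?F = "\<lambda>s. colored_motzkin_paths l \<alpha> \<beta> n (nat (int m - rise s)) \<times> labels l \<alpha> \<beta> s (int m)"
  let ?f = "\<lambda>(s, (w, c), x). (w @ [s], c @ [x])"
  have "inj_on ?f (Sigma ?S ?F)"
    by (auto simp: inj_on_def)
  moreover have "?f ` Sigma ?S ?F = colored_motzkin_paths l \<alpha> \<beta> (Suc n) m"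
  proof (intro equalityI subsetI)
    fix p assume "p \<in> ?f ` Sigma ?S ?F"
    then show "p \<in> colored_motzkin_paths l \<alpha> \<beta> (Suc n) m"
      using length_colored_motzkin_paths snoc_mem_colored_motzkin_paths by fastforce
  next
    fix p assume p: "p \<in> colored_motzkin_paths l \<alpha> \<beta> (Suc n) m"
    obtain v d where vd: "p = (v, d)"
      by (cases p)
    with p have "length v = Suc n" "length d = Suc n"
      using length_colored_motzkin_paths by blast+
    then obtain w s c x where wc: "v = w @ [s]" "length w = n" "d = c @ [x]" "length c = n"
      by (metis length_Suc_conv_rev)
    with p vd have "(s, (w, c), x) \<in> Sigma ?S ?F"
      using snoc_mem_colored_motzkin_paths by auto
    then show "p \<in> ?f ` Sigma ?S ?F"
      using vd wc by (intro image_eqI[where x = "(s, (w, c), x)"]) auto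
  qed
  ultimately have "card (colored_motzkin_paths l \<alpha> \<beta> (Suc n) m) = card (Sigma ?S ?F)"
    using card_image[of ?f "Sigma ?S ?F"] by (simp only:)
  also have "\<dots> = (\<Sum>s\<in>?S. card (?F s))"
    by (intro card_SigmaI ballI finite_cartesian_product finite_colored_motzkin_paths finite_labels)
      auto
  finally show ?thesis
    by (simp add: motzkin_number_def card_cartesian_product)
qed

lemma motzkin_number_Suc:
  "motzkin_number l \<alpha> \<beta> (Suc n) m =
    (if m = 0 then 0 else motzkin_number l \<alpha> \<beta> n (m - 1)) +
    (\<Sum>i\<le>l. motzkin_number l \<alpha> \<beta> n (m + i) * card (labels l \<alpha> \<beta> (D i) (int m)))"
proof -
  let ?g = "\<lambda>s. motzkin_number l \<alpha> \<beta> n (nat (int m - rise s)) * card (labels l \<alpha> \<beta> s (int m))"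
  \<comment> \<open>Each \<open>D i\<close> has rise at most 0, so the bound excludes only
    \<open>U\<close>, and only when \<open>m = 0\<close>.\<close>
  have "{s \<in> insert U (D ` {..l}). rise s \<le> int m} = (if m = 0 then {} else {U}) \<union> D ` {..l}"
    by auto
  moreover have "sum ?g (D ` {..l}) =
      (\<Sum>i\<le>l. motzkin_number l \<alpha> \<beta> n (m + i) * card (labels l \<alpha> \<beta> (D i) (int m)))"
    by (subst sum.reindex) (auto simp: inj_on_def nat_add_distrib simp del: labels.simps)
  moreover have "nat (int m - 1) = m - 1"
    by simp
  ultimately show ?thesis
    by (auto simp: motzkin_number_Suc_sum image_iff simp del: labels.simps(2))
qed

text \<open>A step climbs by at most 1: in the recurrence, every term on the right again has its
  height above its length.\<close>

lemma motzkin_number_eq_0: "n < m \<Longrightarrow> motzkin_number l \<alpha> \<beta> n m = 0"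
  by (induction n arbitrary: m) (simp_all add: motzkin_number_0 motzkin_number_Suc del: labels.simps)

text \<open>The extra color goes to \<open>D 0\<close> steps ending on the axis;
  \<open>l \<ge> 1\<close> makes \<open>D 0\<close> a labeled step.\<close>

lemma card_labels_add_e1_hat:
  assumes "l \<ge> 1"
  shows "card (labels l (\<lambda>i. \<alpha> i + e1_hat i) \<beta> (D i) h) =
    card (labels l \<alpha> \<beta> (D i) h) + (if i = 0 \<and> h = 0 then 1 else 0)"
  using assms by (auto simp: e1_hat_def card_image)

lemma motzkin_number_add_e1_hat:
  assumes "l \<ge> 1"
  shows "motzkin_number l (\<lambda>i. \<alpha> i + e1_hat i) \<alpha> n m =
    motzkin_number l \<alpha> \<alpha> n m + motzkin_number l (\<lambda>i. \<alpha> i + e1_hat i) \<alpha> n (Suc m)"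
proof (induction n arbitrary: m)
  case 0
  show ?case by (simp add: motzkin_number_0)
next
  case (Suc n)
  let ?A = "motzkin_number l \<alpha> \<alpha>" and ?B = "motzkin_number l (\<lambda>i. \<alpha> i + e1_hat i) \<alpha>"
  define c where "c = (\<lambda>i. card (labels l \<alpha> \<alpha> (D i) 0))"
  \<comment> \<open>With equal tuples the number of labels is independent of the endpoint
    height.\<close>
  have c: "card (labels l \<alpha> \<alpha> (D i) h) = c i" for i h
    by (simp add: c_def)
  have A: "?A (Suc n) m = (if m = 0 then 0 else ?A n (m - 1)) + (\<Sum>i\<le>l. ?A n (m + i) * c i)" for m
    by (simp only: motzkin_number_Suc c)
  \<comment> \<open>At \<open>m = 0\<close> truncated subtraction makes the first term
    \<open>?B n 0\<close>, which is exactly the contribution of the extra color of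
    \<open>D 0\<close>.\<close>
  have B: "?B (Suc n) m = ?B n (m - 1) + (\<Sum>i\<le>l. ?B n (m + i) * c i)" for m
    by (cases m)
      (simp_all add: motzkin_number_Suc card_labels_add_e1_hat[OF assms] c distrib_left
        sum.distrib if_distrib[of "\<lambda>x. _ * x"] cong: if_cong del: labels.simps)
  have "?B n (m + i) * c i = ?A n (m + i) * c i + ?B n (Suc m + i) * c i" for i
    using Suc[of "m + i"] by (simp add: distrib_right)
  then have "(\<Sum>i\<le>l. ?B n (m + i) * c i) =
      (\<Sum>i\<le>l. ?A n (m + i) * c i) + (\<Sum>i\<le>l. ?B n (Suc m + i) * c i)"
    by (simp only: sum.distrib)
  \<comment> \<open>Trivial at \<open>m = 0\<close>, where \<open>m - 1\<close> is 0; otherwise the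
    induction hypothesis at \<open>m - 1\<close>.\<close>
  moreover have "?B n (m - 1) = (if m = 0 then 0 else ?A n (m - 1)) + ?B n m"
    using Suc[of "m - 1"] by auto
  ultimately show ?case
    unfolding A B by simp
qed

theorem theorem2p5:
  fixes l :: nat and \<alpha> :: "nat \<Rightarrow> nat"
  assumes "l \<ge> 1"
  shows "(\<lambda>m. motzkin_gf l \<alpha> \<alpha> m) sums motzkin_gf l (\<lambda>i. \<alpha> i + e1_hat i) \<alpha> 0"
proof -
  let ?A = "motzkin_number l \<alpha> \<alpha>" and ?B = "motzkin_number l (\<lambda>i. \<alpha> i + e1_hat i) \<alpha>"
  have telescope: "?B n 0 = (\<Sum>m<k. ?A n m) + ?B n k" for n k
  proof (induction k)
    case (Suc k)
    then show ?case
      using motzkin_number_add_e1_hat[OF assms, of \<alpha> n k] by simp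
  qed simp
  show ?thesis
    unfolding sums_def
  \<comment> \<open>It suffices that each coefficient of the partial sums stabilizes: the one at
    \<open>n\<close> is settled once \<open>k > n\<close>, when the remainder \<open>?B n k\<close>
    vanishes.\<close>
  proof (rule tendsto_fpsI)
    fix n
    have "fps_nth (\<Sum>m<k. motzkin_gf l \<alpha> \<alpha> m) n =
        fps_nth (motzkin_gf l (\<lambda>i. \<alpha> i + e1_hat i) \<alpha> 0) n" if "n < k" for k
      using telescope[of n k] that by (simp add: motzkin_gf_def fps_sum_nth motzkin_number_eq_0)
    then show "\<forall>\<^sub>F k in sequentially. fps_nth (\<Sum>m<k. motzkin_gf l \<alpha> \<alpha> m) n =
        fps_nth (motzkin_gf l (\<lambda>i. \<alpha> i + e1_hat i) \<alpha> 0) n"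
      using eventually_gt_at_top[of n] by (rule eventually_mono[rotated])
  qed
qed

end
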